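(* The functor $E\colon\mathsf{StrPos}\to\mathsf{FinF}$ induces a functor $\mathrm{Mon}(E)\colon \mathrm{Mon}(\mathsf{StrPos})\to\mathrm{Mon}(\mathsf{FinF})$, $(M,\mu,\eta)\mapsto(E(M),E(\mu),E(\eta))$, $f\mapsto E(f)$, from the category of strict pomonoids to the category of finiteness monoids.
   Context: For a set $X$ and a collection $\mathcal{U}\subseteq\mathcal{P}(X)$ of subsets, put $\mathcal{U}^\perp=\{u'\subseteq X \mid u'\cap u \text{ is finite for all } u\in\mathcal{U}\}$. A finiteness space is a pair $(X,\mathcal{U})$ with $X$ a set and $\mathcal{U}\subseteq\mathcal{P}(X)$ such that $\mathcal{U}^{\perp\perp}=\mathcal{U}$. The category $\mathsf{FinF}$ has finiteness spaces as objects; a morphism $(X,\mathcal{U})\to(Y,\mathcal{V})$ is a (total) function $f\colon X\to Y$ such that (1) $f(u)\in\mathcal{V}$ for all $u\in\mathcal{U}$, and (2) $f^{-1}(v')\in\mathcal{U}^\perp$ for all $v'\in\mathcal{V}^\perp$. It is symmetric monoidal with tensor $(X,\mathcal{U})\otimes(Y,\mathcal{V})=(X\times Y,\mathcal{W})$, where $\mathcal{W}=\{u\times v\mid u\in\mathcal{U},v\in\mathcal{V}\}^{\perp\perp}=\{w\mid \exists u\in\mathcal{U},\exists v\in\mathcal{V},\ w\subseteq u\times v\}$, with $f\otimes g=f\times g$ on morphisms, unit $I=(\{*\},\mathcal{P}(\{*\}))$, and the structural isomorphisms of the cartesian product of sets. A map $f\colon P\to Q$ of posets is strict if $p<p'$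 implies $f(p)<f(p')$. $\mathsf{StrPos}$ is the category of posets and strict maps; it is symmetric monoidal with tensor product given by the cartesian product of posets with the componentwise order (the product in the category of posets and order-preserving maps) and unit the one-element poset $\{*\}$. A poset is artinian if every strictly descending chain in it is finite, and narrow if every subset of pairwise incomparable elements is finite; a subset of a poset is artinian or narrow if it is so for the induced order. The functor $E\colon\mathsf{StrPos}\to\mathsf{FinF}$ sends a poset $(P,\leq)$ to the finiteness space $(P,\mathcal{U})$, where $\mathcal{U}$ is the set of artinian and narrow subsets of $P$, and a strict map $f$ to $E(f)=f$. $\mathrm{Mon}(\mathcal{C})$ denotes the category of internal monoids and monoid morphisms in a monoidal category $\mathcal{C}$. A finiteness monoid is an internal monoid in $\mathsf{FinF}$. A strict pomonoid is a partially ordered monoid $(M,\cdot,\leq)$ (multiplication order-preserving) such that $s<s'$ implies $s\cdot t<s'\cdot t$ and $t\cdot s<t\cdot s'$ for all $s,s',t\in M$; strict pomonoids are exactly the internal monoids in $\mathsf{StrPos}$. *)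

theory Defs
  imports Main "HOL-Library.FuncSet"
begin

section \<open>Categories, monoidal categories and internal monoids\<close>

record ('o, 'm) category_data =
  Obj :: "'o set"
  Arr :: "'m set"
  Dom :: "'m \<Rightarrow> 'o"
  Cod :: "'m \<Rightarrow> 'o"
  Ide :: "'o \<Rightarrow> 'm"
  Comp :: "'m \<Rightarrow> 'm \<Rightarrow> 'm"  (infixr "\<cdot>\<index>" 65)

definition Hom :: "('o, 'm, 'z) category_data_scheme \<Rightarrow> 'o \<Rightarrow> 'o \<Rightarrow> 'm set" where
  "Hom C X Y = {f \<in> Arr C. Dom C f = X \<and> Cod C f = Y}"

locale category =
  fixes C :: "('o, 'm, 'z) category_data_scheme" (structure)
  assumes dom_obj: "f \<in> Arr C \<Longrightarrow> Dom C f \<in> Obj C"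
    and cod_obj: "f \<in> Arr C \<Longrightarrow> Cod C f \<in> Obj C"
    and ide_hom: "X \<in> Obj C \<Longrightarrow> Ide C X \<in> Hom C X X"
    and comp_hom: "f \<in> Hom C X Y \<Longrightarrow> g \<in> Hom C Y Z \<Longrightarrow> g \<cdot> f \<in> Hom C X Z"
    and comp_ide_left: "f \<in> Hom C X Y \<Longrightarrow> Ide C Y \<cdot> f = f"
    and comp_ide_right: "f \<in> Hom C X Y \<Longrightarrow> f \<cdot> Ide C X = f"
    and comp_assoc: "f \<in> Hom C W X \<Longrightarrow> g \<in> Hom C X Y \<Longrightarrow> h \<in> Hom C Y Z \<Longrightarrow>
      (h \<cdot> g) \<cdot> f = h \<cdot> (g \<cdot> f)"

record ('o, 'm, 'p, 'n) functor_data =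
  on_obj :: "'o \<Rightarrow> 'p"
  on_arr :: "'m \<Rightarrow> 'n"

locale is_functor = source: category C + target: category D
  for C :: "('o, 'm, 'y) category_data_scheme"
    and D :: "('p, 'n, 'z) category_data_scheme"
    and F :: "('o, 'm, 'p, 'n) functor_data" +
  assumes obj: "X \<in> Obj C \<Longrightarrow> on_obj F X \<in> Obj D"
    and arr: "f \<in> Hom C X Y \<Longrightarrow> on_arr F f \<in> Hom D (on_obj F X) (on_obj F Y)"
    and ide: "X \<in> Obj C \<Longrightarrow> on_arr F (Ide C X) = Ide D (on_obj F X)"
    and comp: "f \<in> Hom C X Y \<Longrightarrow> g \<in> Hom C Y Z \<Longrightarrow>
      on_arr F (Comp C g f) = Comp D (on_arr F g) (on_arr F f)"

record ('o, 'm) monoidal_data = "('o, 'm) category_data" +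
  Tensor :: "'o \<Rightarrow> 'o \<Rightarrow> 'o"  (infixr "\<otimes>\<index>" 70)
  TensorArr :: "'m \<Rightarrow> 'm \<Rightarrow> 'm"  (infixr "\<odot>\<index>" 70)
  Unit :: "'o"
  Assoc :: "'o \<Rightarrow> 'o \<Rightarrow> 'o \<Rightarrow> 'm"
  LUnit :: "'o \<Rightarrow> 'm"
  RUnit :: "'o \<Rightarrow> 'm"

definition Iso :: "('o, 'm, 'z) category_data_scheme \<Rightarrow> 'o \<Rightarrow> 'o \<Rightarrow> 'm set" where
  "Iso C X Y = {f \<in> Hom C X Y. \<exists>g \<in> Hom C Y X. Comp C g f = Ide C X \<and> Comp C f g = Ide C Y}"

locale monoidal_category = category C
  for C :: "('o, 'm, 'z) monoidal_data_scheme" (structure) +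
  assumes tensor_obj: "X \<in> Obj C \<Longrightarrow> Y \<in> Obj C \<Longrightarrow> X \<otimes> Y \<in> Obj C"
    and unit_obj: "Unit C \<in> Obj C"
    and tensor_hom: "f \<in> Hom C X X' \<Longrightarrow> g \<in> Hom C Y Y' \<Longrightarrow> f \<odot> g \<in> Hom C (X \<otimes> Y) (X' \<otimes> Y')"
    and tensor_ide: "X \<in> Obj C \<Longrightarrow> Y \<in> Obj C \<Longrightarrow> Ide C X \<odot> Ide C Y = Ide C (X \<otimes> Y)"
    and tensor_comp: "f \<in> Hom C X X' \<Longrightarrow> f' \<in> Hom C X' X'' \<Longrightarrow>
      g \<in> Hom C Y Y' \<Longrightarrow> g' \<in> Hom C Y' Y'' \<Longrightarrow> (f' \<cdot> f) \<odot> (g' \<cdot> g) = (f' \<odot> g') \<cdot> (f \<odot> g)"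
    and assoc_iso: "X \<in> Obj C \<Longrightarrow> Y \<in> Obj C \<Longrightarrow> Z \<in> Obj C \<Longrightarrow>
      Assoc C X Y Z \<in> Iso C ((X \<otimes> Y) \<otimes> Z) (X \<otimes> (Y \<otimes> Z))"
    and lunit_iso: "X \<in> Obj C \<Longrightarrow> LUnit C X \<in> Iso C (Unit C \<otimes> X) X"
    and runit_iso: "X \<in> Obj C \<Longrightarrow> RUnit C X \<in> Iso C (X \<otimes> Unit C) X"
    and assoc_natural: "f \<in> Hom C X X' \<Longrightarrow> g \<in> Hom C Y Y' \<Longrightarrow> h \<in> Hom C Z Z' \<Longrightarrow>
      Assoc C X' Y' Z' \<cdot> ((f \<odot> g) \<odot> h) = (f \<odot> (g \<odot> h)) \<cdot> Assoc C X Y Z"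
    and lunit_natural: "f \<in> Hom C X Y \<Longrightarrow> LUnit C Y \<cdot> (Ide C (Unit C) \<odot> f) = f \<cdot> LUnit C X"
    and runit_natural: "f \<in> Hom C X Y \<Longrightarrow> RUnit C Y \<cdot> (f \<odot> Ide C (Unit C)) = f \<cdot> RUnit C X"
    and pentagon: "W \<in> Obj C \<Longrightarrow> X \<in> Obj C \<Longrightarrow> Y \<in> Obj C \<Longrightarrow> Z \<in> Obj C \<Longrightarrow>
      (Ide C W \<odot> Assoc C X Y Z) \<cdot> (Assoc C W (X \<otimes> Y) Z \<cdot> (Assoc C W X Y \<odot> Ide C Z))
      = Assoc C W X (Y \<otimes> Z) \<cdot> Assoc C (W \<otimes> X) Y Z"
    and triangle: "X \<in> Obj C \<Longrightarrow> Y \<in> Obj C \<Longrightarrow>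
      (Ide C X \<odot> LUnit C Y) \<cdot> Assoc C X (Unit C) Y = RUnit C X \<odot> Ide C Y"

context monoidal_category
begin

definition internal_monoid :: "'o \<times> 'm \<times> 'm \<Rightarrow> bool" where
  "internal_monoid = (\<lambda>(M, \<mu>, \<eta>).
     M \<in> Obj C \<and> \<mu> \<in> Hom C (M \<otimes> M) M \<and> \<eta> \<in> Hom C (Unit C) M \<and>
     \<mu> \<cdot> (\<mu> \<odot> Ide C M) = \<mu> \<cdot> ((Ide C M \<odot> \<mu>) \<cdot> Assoc C M M M) \<and>
     \<mu> \<cdot> (\<eta> \<odot> Ide C M) = LUnit C M \<and>
     \<mu> \<cdot> (Ide C M \<odot> \<eta>) = RUnit C M)"

definition monoid_morphism :: "'o \<times> 'm \<times> 'm \<Rightarrow> 'o \<times> 'm \<times> 'm \<Rightarrow> 'm \<Rightarrow> bool" where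
  "monoid_morphism = (\<lambda>(M, \<mu>, \<eta>) (N, \<nu>, \<epsilon>) f.
     f \<in> Hom C M N \<and> f \<cdot> \<mu> = \<nu> \<cdot> (f \<odot> f) \<and> f \<cdot> \<eta> = \<epsilon>)"

text \<open>Arrows of the category of monoids carry their source and target, since one arrow of the underlying category may be a
  morphism between several pairs of monoids.\<close>

definition Mon ::
    "('o \<times> 'm \<times> 'm, ('o \<times> 'm \<times> 'm) \<times> 'm \<times> ('o \<times> 'm \<times> 'm)) category_data" where
  "Mon = \<lparr>
     Obj = {A. internal_monoid A},
     Arr = {(A, f, B). internal_monoid A \<and> internal_monoid B \<and> monoid_morphism A B f},
     Dom = (\<lambda>(A, f, B). A),
     Cod = (\<lambda>(A, f, B). B),
     Ide = (\<lambda>A. (A, Ide C (fst A), A)),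
     Comp = (\<lambda>(B', g, D) (A, f, B). (A, g \<cdot> f, D))\<rparr>"

end

text \<open>No comparison arrow \<open>F M \<otimes> F M \<rightarrow> F (M \<otimes> M)\<close> is inserted: \<open>F \<mu>\<close> itself is the new
  multiplication, so that it can only be an arrow \<open>F M \<otimes> F M \<rightarrow> F M\<close> if
  \<open>F M \<otimes> F M = F (M \<otimes> M)\<close>; likewise for the unit.\<close>

definition Mon_functor :: "('o, 'm, 'p, 'n) functor_data \<Rightarrow>
    ('o \<times> 'm \<times> 'm, ('o \<times> 'm \<times> 'm) \<times> 'm \<times> ('o \<times> 'm \<times> 'm),
     'p \<times> 'n \<times> 'n, ('p \<times> 'n \<times> 'n) \<times> 'n \<times> ('p \<times> 'n \<times> 'n)) functor_data" where
  "Mon_functor F =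
    (let F' = (\<lambda>(M, \<mu>, \<eta>). (on_obj F M, on_arr F \<mu>, on_arr F \<eta>))
     in \<lparr> on_obj = F', on_arr = (\<lambda>(A, f, B). (F' A, on_arr F f, F' B)) \<rparr>)"


section \<open>Sets with structure\<close>

text \<open>All underlying sets are subsets of one type that is closed under pairing and contains a
  one-element set; it is freely generated by an arbitrary type \<open>'a\<close> of atoms, so every set of
  elements of any type \<open>'a\<close> occurs. This plays the role of the universe of sets.\<close>

datatype 'a univ = Atom 'a | Star | Pr (left: "'a univ") (right: "'a univ")

definition cart :: "'a univ set \<Rightarrow> 'a univ set \<Rightarrow> 'a univ set" where
  "cart A B = {Pr a b | a b. a \<in> A \<and> b \<in> B}"

text \<open>An object is a set together with a structure of type \<open>'s\<close>. An arrow is a function with its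
  source and target; the function is \<open>undefined\<close> outside the source, so that equality of arrows is
  equality on the source.\<close>

type_synonym ('a, 's) sobj = "'a univ set \<times> 's"
type_synonym ('a, 's) sarr = "('a, 's) sobj \<times> ('a univ \<Rightarrow> 'a univ) \<times> ('a, 's) sobj"

text \<open>The monoidal category of sets with structure whose tensor product lies over the cartesian
  product of sets, with the maps and structural isomorphisms of the latter.\<close>

definition structured_sets ::
  "('a, 's) sobj set \<Rightarrow> (('a, 's) sobj \<Rightarrow> ('a, 's) sobj \<Rightarrow> ('a univ \<Rightarrow> 'a univ) \<Rightarrow> bool) \<Rightarrow>
   (('a, 's) sobj \<Rightarrow> ('a, 's) sobj \<Rightarrow> ('a, 's) sobj) \<Rightarrow> ('a, 's) sobj \<Rightarrow>
   (('a, 's) sobj, ('a, 's) sarr) monoidal_data" where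
  "structured_sets obs mor ten I = \<lparr>
     Obj = obs,
     Arr = {(X, f, Y). X \<in> obs \<and> Y \<in> obs \<and> f \<in> fst X \<rightarrow>\<^sub>E fst Y \<and> mor X Y f},
     Dom = (\<lambda>(X, f, Y). X),
     Cod = (\<lambda>(X, f, Y). Y),
     Ide = (\<lambda>X. (X, restrict (\<lambda>x. x) (fst X), X)),
     Comp = (\<lambda>(Y', g, Z) (X, f, Y). (X, compose (fst X) g f, Z)),
     Tensor = ten,
     TensorArr = (\<lambda>(X, f, X') (Y, g, Y').
       (ten X Y, restrict (\<lambda>p. Pr (f (left p)) (g (right p))) (cart (fst X) (fst Y)), ten X' Y')),
     Unit = I,
     Assoc = (\<lambda>X Y Z. (ten (ten X Y) Z,
       restrict (\<lambda>p. Pr (left (left p)) (Pr (right (left p)) (right p)))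
         (cart (cart (fst X) (fst Y)) (fst Z)),
       ten X (ten Y Z))),
     LUnit = (\<lambda>X. (ten I X, restrict right (cart (fst I) (fst X)), X)),
     RUnit = (\<lambda>X. (ten X I, restrict left (cart (fst X) (fst I)), X))\<rparr>"


section \<open>Posets and strict maps\<close>

text \<open>\<open>(x, y) \<in> r\<close> stands for \<open>x \<le> y\<close>.\<close>

definition strict_part :: "'b rel \<Rightarrow> 'b rel" where
  "strict_part r = {(x, y) \<in> r. x \<noteq> y}"

definition strict_map :: "'b set \<times> 'b rel \<Rightarrow> 'c set \<times> 'c rel \<Rightarrow> ('b \<Rightarrow> 'c) \<Rightarrow> bool" where
  "strict_map P Q f \<longleftrightarrow> (\<forall>(x, y) \<in> strict_part (snd P). (f x, f y) \<in> strict_part (snd Q))"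

definition StrPos ::
  "(('a, 'a univ rel) sobj, ('a, 'a univ rel) sarr) monoidal_data" where
  "StrPos = structured_sets
     {(P, r). partial_order_on P r}
     strict_map
     (\<lambda>(P, r) (Q, s). (cart P Q, {(Pr p q, Pr p' q') | p q p' q'. (p, p') \<in> r \<and> (q, q') \<in> s}))
     ({Star}, {(Star, Star)})"


section \<open>Finiteness spaces\<close>

definition perp :: "'b set \<Rightarrow> 'b set set \<Rightarrow> 'b set set" where
  "perp X \<U> = {u'. u' \<subseteq> X \<and> (\<forall>u \<in> \<U>. finite (u' \<inter> u))}"

definition finiteness_space :: "'b set \<times> 'b set set \<Rightarrow> bool" where
  "finiteness_space = (\<lambda>(X, \<U>). \<U> \<subseteq> Pow X \<and> perp X (perp X \<U>) = \<U>)"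

definition finiteness_map ::
  "'b set \<times> 'b set set \<Rightarrow> 'c set \<times> 'c set set \<Rightarrow> ('b \<Rightarrow> 'c) \<Rightarrow> bool" where
  "finiteness_map = (\<lambda>(X, \<U>) (Y, \<V>) f.
     (\<forall>u \<in> \<U>. f ` u \<in> \<V>) \<and> (\<forall>v' \<in> perp Y \<V>. f -` v' \<inter> X \<in> perp X \<U>))"

definition FinF ::
  "(('a, 'a univ set set) sobj, ('a, 'a univ set set) sarr) monoidal_data" where
  "FinF = structured_sets
     {X. finiteness_space X}
     finiteness_map
     (\<lambda>(X, \<U>) (Y, \<V>). (cart X Y,
        perp (cart X Y) (perp (cart X Y) {cart u v | u v. u \<in> \<U> \<and> v \<in> \<V>})))
     ({Star}, Pow {Star})"


section \<open>The finiteness space of artinian and narrow subsets\<close>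

definition artinian :: "'b set \<times> 'b rel \<Rightarrow> bool" where
  "artinian = (\<lambda>(P, r). \<nexists>s :: nat \<Rightarrow> 'b. \<forall>n. s n \<in> P \<and> (s (Suc n), s n) \<in> strict_part r)"

definition narrow :: "'b set \<times> 'b rel \<Rightarrow> bool" where
  "narrow = (\<lambda>(P, r). \<forall>B \<subseteq> P.
     (\<forall>x \<in> B. \<forall>y \<in> B. x \<noteq> y \<longrightarrow> (x, y) \<notin> r \<and> (y, x) \<notin> r) \<longrightarrow> finite B)"

definition E_obj :: "'b set \<times> 'b rel \<Rightarrow> 'b set \<times> 'b set set" where
  "E_obj = (\<lambda>(P, r). (P, {A. A \<subseteq> P \<and> artinian (A, Restr r A) \<and> narrow (A, Restr r A)}))"

definition E :: "(('a, 'a univ rel) sobj, ('a, 'a univ rel) sarr,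
    ('a, 'a univ set set) sobj, ('a, 'a univ set set) sarr) functor_data" where
  "E = \<lparr> on_obj = E_obj, on_arr = (\<lambda>(P, f, Q). (E_obj P, f, E_obj Q)) \<rparr>"

end

theory Submission
  imports Defs "HOL-Library.Ramsey"
begin

text \<open>A strict monoidal functor preserves internal monoids and their morphisms, so it suffices that \<open>E\<close> is
  one; the only points with content are that \<open>E P\<close> is a finiteness space, that strict maps are finiteness
  maps and that \<open>E (P \<times> Q) = E P \<otimes> E Q\<close>. All three follow once artinian and narrow subsets \<open>A\<close> are
  recognised as the well-partial-ordered ones: every sequence \<open>s\<close> in \<open>A\<close> has \<open>s i \<le> s j\<close> for some \<open>i < j\<close>.
  For instance, a sequence in \<open>A\<close> violating this condition has a range which is in \<open>\<U>\<^sup>\<bottom>\<close> but meets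
  \<open>A\<close> in an infinite set, whence \<open>\<U>\<^sup>\<bottom>\<^sup>\<bottom> = \<U>\<close>. The condition passes to products, as each sequence in a
  well-partial-order has an ascending subsequence by Ramsey's theorem.\<close>

section \<open>Strict monoidal functors act on monoids\<close>

context monoidal_category
begin

lemma monoid_morphism_ide:
  assumes "internal_monoid A"
  shows "monoid_morphism A A (Ide C (fst A))"
proof -
  obtain M m e where A: "A = (M, m, e)" by (cases A)
  have M: "M \<in> Obj C" and m: "m \<in> Hom C (M \<otimes> M) M" and e: "e \<in> Hom C (Unit C) M"
    using assms by (auto simp: internal_monoid_def A)
  then show ?thesis
    by (simp add: monoid_morphism_def A ide_hom tensor_ide comp_ide_left[OF m]
        comp_ide_right[OF m] comp_ide_left[OF e])
qed

lemma monoid_morphism_comp: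
  assumes "internal_monoid A" "internal_monoid B" "internal_monoid D"
    and "monoid_morphism A B f" "monoid_morphism B D g"
  shows "monoid_morphism A D (g \<cdot> f)"
proof -
  obtain M m e where A: "A = (M, m, e)" by (cases A)
  obtain N n i where B: "B = (N, n, i)" by (cases B)
  obtain K k j where D: "D = (K, k, j)" by (cases D)
  have m: "m \<in> Hom C (M \<otimes> M) M" and e: "e \<in> Hom C (Unit C) M"
    and n: "n \<in> Hom C (N \<otimes> N) N" and k: "k \<in> Hom C (K \<otimes> K) K"
    using assms by (auto simp: internal_monoid_def A B D)
  have f: "f \<in> Hom C M N" "f \<cdot> m = n \<cdot> (f \<odot> f)" "f \<cdot> e = i"
    and g: "g \<in> Hom C N K" "g \<cdot> n = k \<cdot> (g \<odot> g)" "g \<cdot> i = j"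
    using assms by (auto simp: monoid_morphism_def A B D)
  have ff: "f \<odot> f \<in> Hom C (M \<otimes> M) (N \<otimes> N)" and gg: "g \<odot> g \<in> Hom C (N \<otimes> N) (K \<otimes> K)"
    using f g by (auto intro: tensor_hom)
  have "(g \<cdot> f) \<cdot> m = (g \<cdot> n) \<cdot> (f \<odot> f)"
    using comp_assoc[OF m f(1) g(1)] comp_assoc[OF ff n g(1)] f(2) by simp
  also have "\<dots> = k \<cdot> ((g \<cdot> f) \<odot> (g \<cdot> f))"
    using comp_assoc[OF ff gg k] g(2) tensor_comp[OF f(1) g(1) f(1) g(1)] by simp
  finally show ?thesis
    using comp_assoc[OF e f(1) g(1)] f g comp_hom[OF f(1) g(1)]
    by (simp add: monoid_morphism_def A D)
qed

lemma mem_Hom_Mon_iff: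
  "a \<in> Hom Mon A B \<longleftrightarrow> (\<exists>f. a = (A, f, B) \<and> internal_monoid A \<and> internal_monoid B \<and>
     monoid_morphism A B f)"
  by (auto simp: Hom_def Mon_def)

lemma Obj_Mon [simp]: "Obj Mon = {A. internal_monoid A}"
  and Ide_Mon [simp]: "Ide Mon A = (A, Ide C (fst A), A)"
  and Comp_Mon [simp]: "Comp Mon (B', g, D) (A, f, B) = (A, g \<cdot> f, D)"
  by (simp_all add: Mon_def)

lemma monoid_morphism_hom: "monoid_morphism A B f \<Longrightarrow> f \<in> Hom C (fst A) (fst B)"
  by (cases A; cases B) (simp add: monoid_morphism_def)

lemma category_Mon: "category Mon"
proof
  show "Dom Mon f \<in> Obj Mon" "Cod Mon f \<in> Obj Mon" if "f \<in> Arr Mon" for f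
    using that by (auto simp: Mon_def)
  show "Ide Mon X \<in> Hom Mon X X" if "X \<in> Obj Mon" for X
    using that by (simp add: mem_Hom_Mon_iff monoid_morphism_ide)
  show "Comp Mon g f \<in> Hom Mon X Z" if "f \<in> Hom Mon X Y" "g \<in> Hom Mon Y Z" for f g X Y Z
    using that by (auto simp: mem_Hom_Mon_iff intro: monoid_morphism_comp)
  show "Comp Mon (Ide Mon Y) f = f" "Comp Mon f (Ide Mon X) = f" if "f \<in> Hom Mon X Y" for f X Y
    using that comp_ide_left comp_ide_right
    by (auto simp: mem_Hom_Mon_iff dest!: monoid_morphism_hom)
  show "Comp Mon (Comp Mon h g) f = Comp Mon h (Comp Mon g f)"
    if "f \<in> Hom Mon W X" "g \<in> Hom Mon X Y" "h \<in> Hom Mon Y Z" for f g h W X Y Z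
    using that comp_assoc by (auto simp: mem_Hom_Mon_iff dest!: monoid_morphism_hom)
qed

end

text \<open>Preservation is demanded as equality, not up to comparison isomorphisms, because
  \<open>Mon_functor\<close> takes \<open>on_arr F \<mu>\<close> itself as multiplication, which has
  the right source only if the tensor products agree.\<close>

locale strict_monoidal_functor =
  source: monoidal_category C + target: monoidal_category D + is_functor C D F
  for C :: "('o, 'm, 'y) monoidal_data_scheme"
    and D :: "('p, 'n, 'z) monoidal_data_scheme"
    and F :: "('o, 'm, 'p, 'n) functor_data" +
  assumes tensor: "X \<in> Obj C \<Longrightarrow> Y \<in> Obj C \<Longrightarrow>
      on_obj F (Tensor C X Y) = Tensor D (on_obj F X) (on_obj F Y)"
    and tensor_arr: "f \<in> Hom C X X' \<Longrightarrow> g \<in> Hom C Y Y' \<Longrightarrow>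
      on_arr F (TensorArr C f g) = TensorArr D (on_arr F f) (on_arr F g)"
    and unit: "on_obj F (Unit C) = Unit D"
    and assoc: "X \<in> Obj C \<Longrightarrow> Y \<in> Obj C \<Longrightarrow> Z \<in> Obj C \<Longrightarrow>
      on_arr F (Assoc C X Y Z) = Assoc D (on_obj F X) (on_obj F Y) (on_obj F Z)"
    and lunit: "X \<in> Obj C \<Longrightarrow> on_arr F (LUnit C X) = LUnit D (on_obj F X)"
    and runit: "X \<in> Obj C \<Longrightarrow> on_arr F (RUnit C X) = RUnit D (on_obj F X)"
begin

text \<open>The monoid axioms are equations between composites of \<open>m\<close>,
  \<open>e\<close>, identities, tensor products and structural isomorphisms. \<open>F\<close>
  commutes with all of these, so the image of an axiom is the same axiom for the image.\<close>

lemma internal_monoid_image: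
  assumes "source.internal_monoid (M, m, e)"
  shows "target.internal_monoid (on_obj F M, on_arr F m, on_arr F e)"
proof -
  have M: "M \<in> Obj C" and m: "m \<in> Hom C (Tensor C M M) M" and e: "e \<in> Hom C (Unit C) M"
    and ax: "Comp C m (TensorArr C m (Ide C M)) =
        Comp C m (Comp C (TensorArr C (Ide C M) m) (Assoc C M M M))"
      "Comp C m (TensorArr C e (Ide C M)) = LUnit C M"
      "Comp C m (TensorArr C (Ide C M) e) = RUnit C M"
    using assms by (auto simp: source.internal_monoid_def)
  have i: "Ide C M \<in> Hom C M M" using M by (rule source.ide_hom)
  have a: "Assoc C M M M \<in> Hom C (Tensor C (Tensor C M M) M) (Tensor C M (Tensor C M M))"
    using source.assoc_iso[OF M M M] by (simp add: Iso_def)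
  \<comment> \<open>The composition law of \<open>F\<close> is conditional on composability, so the
    sources and targets of all factors are recorded first.\<close>
  note mi = source.tensor_hom[OF m i] and im = source.tensor_hom[OF i m]
    and ei = source.tensor_hom[OF e i] and ie = source.tensor_hom[OF i e]
  note ax' = ax[THEN arg_cong[of _ _ "on_arr F"]]
  show ?thesis
    using obj[OF M] arr[OF m] arr[OF e] ax' M
    by (simp add: target.internal_monoid_def comp[OF mi m] comp[OF im m] comp[OF a im]
        comp[OF source.comp_hom[OF a im] m] comp[OF ei m] comp[OF ie m]
        tensor_arr[OF m i] tensor_arr[OF i m] tensor_arr[OF e i] tensor_arr[OF i e]
        tensor unit assoc lunit runit ide)
qed

lemma monoid_morphism_image:
  assumes "source.internal_monoid (M, m, e)" "source.internal_monoid (N, n, i)"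
    and "source.monoid_morphism (M, m, e) (N, n, i) f"
  shows "target.monoid_morphism (on_obj F M, on_arr F m, on_arr F e)
    (on_obj F N, on_arr F n, on_arr F i) (on_arr F f)"
proof -
  have m: "m \<in> Hom C (Tensor C M M) M" and e: "e \<in> Hom C (Unit C) M"
    and n: "n \<in> Hom C (Tensor C N N) N"
    using assms by (auto simp: source.internal_monoid_def)
  have f: "f \<in> Hom C M N" and ax: "Comp C f m = Comp C n (TensorArr C f f)" "Comp C f e = i"
    using assms by (auto simp: source.monoid_morphism_def)
  note ax' = ax[THEN arg_cong[of _ _ "on_arr F"]]
  show ?thesis
    using arr[OF f] ax'
    by (simp add: target.monoid_morphism_def comp[OF m f] comp[OF e f]
        comp[OF source.tensor_hom[OF f f] n] tensor_arr[OF f f])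
qed

theorem is_functor_Mon: "is_functor source.Mon target.Mon (Mon_functor F)"
proof -
  interpret S: category source.Mon by (rule source.category_Mon)
  interpret T: category target.Mon by (rule target.category_Mon)
  show ?thesis
  proof
    show "on_obj (Mon_functor F) X \<in> Obj target.Mon" if "X \<in> Obj source.Mon" for X
      using that by (cases X) (auto simp: Mon_functor_def Let_def intro: internal_monoid_image)
    show "on_arr (Mon_functor F) f \<in>
        Hom target.Mon (on_obj (Mon_functor F) X) (on_obj (Mon_functor F) Y)"
      if "f \<in> Hom source.Mon X Y" for f X Y
      using that
      by (cases X; cases Y)
        (auto simp: Mon_functor_def Let_def source.mem_Hom_Mon_iff target.mem_Hom_Mon_iff
          intro: internal_monoid_image monoid_morphism_image)
    show "on_arr (Mon_functor F) (Ide source.Mon X) = Ide target.Mon (on_obj (Mon_functor F) X)"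
      if "X \<in> Obj source.Mon" for X
      using that ide by (cases X) (auto simp: Mon_functor_def Let_def source.internal_monoid_def)
    show "on_arr (Mon_functor F) (Comp source.Mon g f) =
        Comp target.Mon (on_arr (Mon_functor F) g) (on_arr (Mon_functor F) f)"
      if "f \<in> Hom source.Mon X Y" "g \<in> Hom source.Mon Y Z" for f g X Y Z
      using that comp
      by (cases X; cases Y; cases Z)
        (auto simp: Mon_functor_def Let_def source.mem_Hom_Mon_iff dest!: source.monoid_morphism_hom)
  qed
qed

end

section \<open>Sets with structure\<close>

lemma mem_cart [simp]: "Pr a b \<in> cart A B \<longleftrightarrow> a \<in> A \<and> b \<in> B"
  by (auto simp: cart_def)

lemma cartE: "p \<in> cart A B \<Longrightarrow> (\<And>a b. p = Pr a b \<Longrightarrow> a \<in> A \<Longrightarrow> b \<in> B \<Longrightarrow> thesis) \<Longrightarrow> thesis"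
  by (auto simp: cart_def)

abbreviation (input) map_pr where
  "map_pr f g \<equiv> (\<lambda>p. Pr (f (left p)) (g (right p)))"

abbreviation (input) assoc_map where
  "assoc_map \<equiv> (\<lambda>p. Pr (left (left p)) (Pr (right (left p)) (right p)))"

abbreviation (input) coassoc_map where
  "coassoc_map \<equiv> (\<lambda>p. Pr (Pr (left p) (left (right p))) (right (right p)))"

text \<open>These are the checks left for \<open>structured_sets\<close> to be a monoidal category,
  since its equations are inherited from sets. Inverses of the structural maps occur separately, as
  the inverse of a bijective morphism may fail to be one. \<open>mor_cong\<close> lets morphisms be
  tested on plain formulas although arrows carry restricted functions.\<close>

locale set_structure =
  fixes obs :: "('a, 's) sobj set"
    and mor :: "('a, 's) sobj \<Rightarrow> ('a, 's) sobj \<Rightarrow> ('a univ \<Rightarrow> 'a univ) \<Rightarrow> bool"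
    and ten :: "('a, 's) sobj \<Rightarrow> ('a, 's) sobj \<Rightarrow> ('a, 's) sobj"
    and I :: "('a, 's) sobj"
  assumes mor_cong: "X \<in> obs \<Longrightarrow> (\<And>x. x \<in> fst X \<Longrightarrow> f x = g x) \<Longrightarrow> mor X Y f = mor X Y g"
    and mor_id: "X \<in> obs \<Longrightarrow> mor X X (\<lambda>x. x)"
    and mor_comp: "X \<in> obs \<Longrightarrow> Y \<in> obs \<Longrightarrow> Z \<in> obs \<Longrightarrow> f \<in> fst X \<rightarrow> fst Y \<Longrightarrow>
      mor X Y f \<Longrightarrow> mor Y Z g \<Longrightarrow> mor X Z (\<lambda>x. g (f x))"
    and ten_obs: "X \<in> obs \<Longrightarrow> Y \<in> obs \<Longrightarrow> ten X Y \<in> obs"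
    and fst_ten [simp]: "fst (ten X Y) = cart (fst X) (fst Y)"
    and I_obs: "I \<in> obs"
    and fst_I [simp]: "fst I = {Star}"
    and mor_ten: "X \<in> obs \<Longrightarrow> X' \<in> obs \<Longrightarrow> Y \<in> obs \<Longrightarrow> Y' \<in> obs \<Longrightarrow>
      f \<in> fst X \<rightarrow> fst X' \<Longrightarrow> g \<in> fst Y \<rightarrow> fst Y' \<Longrightarrow>
      mor X X' f \<Longrightarrow> mor Y Y' g \<Longrightarrow> mor (ten X Y) (ten X' Y') (map_pr f g)"
    and mor_assoc: "X \<in> obs \<Longrightarrow> Y \<in> obs \<Longrightarrow> Z \<in> obs \<Longrightarrow>
      mor (ten (ten X Y) Z) (ten X (ten Y Z)) assoc_map"
    and mor_coassoc: "X \<in> obs \<Longrightarrow> Y \<in> obs \<Longrightarrow> Z \<in> obs \<Longrightarrow>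
      mor (ten X (ten Y Z)) (ten (ten X Y) Z) coassoc_map"
    and mor_lunit: "X \<in> obs \<Longrightarrow> mor (ten I X) X right"
    and mor_colunit: "X \<in> obs \<Longrightarrow> mor X (ten I X) (Pr Star)"
    and mor_runit: "X \<in> obs \<Longrightarrow> mor (ten X I) X left"
    and mor_corunit: "X \<in> obs \<Longrightarrow> mor X (ten X I) (\<lambda>x. Pr x Star)"
begin

abbreviation "S \<equiv> structured_sets obs mor ten I"

lemma Obj_S [simp]: "Obj S = obs"
  and Ide_S [simp]: "Ide S X = (X, restrict (\<lambda>x. x) (fst X), X)"
  and Comp_S [simp]: "Comp S (Y', g, Z) (X, f, Y) = (X, compose (fst X) g f, Z)"
  and Tensor_S [simp]: "Tensor S = ten"
  and TensorArr_S [simp]: "TensorArr S (X, f, X') (Y, g, Y') =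
    (ten X Y, restrict (map_pr f g) (cart (fst X) (fst Y)), ten X' Y')"
  and Unit_S [simp]: "Unit S = I"
  and Assoc_S [simp]: "Assoc S X Y Z = (ten (ten X Y) Z,
    restrict assoc_map (cart (cart (fst X) (fst Y)) (fst Z)), ten X (ten Y Z))"
  and LUnit_S [simp]: "LUnit S X = (ten I X, restrict right (cart (fst I) (fst X)), X)"
  and RUnit_S [simp]: "RUnit S X = (ten X I, restrict left (cart (fst X) (fst I)), X)"
  by (simp_all add: structured_sets_def)

lemma mem_Hom_S_iff:
  "a \<in> Hom S X Y \<longleftrightarrow> (\<exists>f. a = (X, f, Y) \<and> X \<in> obs \<and> Y \<in> obs \<and> f \<in> fst X \<rightarrow>\<^sub>E fst Y \<and> mor X Y f)"
  by (auto simp: Hom_def structured_sets_def)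

lemma mor_restrict: "X \<in> obs \<Longrightarrow> A = fst X \<Longrightarrow> mor X Y (restrict f A) = mor X Y f"
  by (rule mor_cong) auto

lemma restrict_Hom_S:
  assumes "X \<in> obs" "Y \<in> obs" "f \<in> fst X \<rightarrow> fst Y" "mor X Y f" "A = fst X"
  shows "(X, restrict f A, Y) \<in> Hom S X Y"
  using assms by (auto simp: mem_Hom_S_iff mor_restrict)

lemma restrict_Iso_S:
  assumes "X \<in> obs" "Y \<in> obs" "f \<in> fst X \<rightarrow> fst Y" "mor X Y f" "A = fst X"
    and "g \<in> fst Y \<rightarrow> fst X" "mor Y X g"
    and "\<And>x. x \<in> fst X \<Longrightarrow> g (f x) = x" "\<And>y. y \<in> fst Y \<Longrightarrow> f (g y) = y"
  shows "(X, restrict f A, Y) \<in> Iso S X Y"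
proof -
  have "(Y, restrict g (fst Y), X) \<in> Hom S Y X" using assms by (intro restrict_Hom_S) auto
  moreover have "(X, restrict f A, Y) \<in> Hom S X Y" using assms by (intro restrict_Hom_S) auto
  moreover have "compose (fst X) (restrict g (fst Y)) (restrict f A) = restrict (\<lambda>x. x) (fst X)"
    "compose (fst Y) (restrict f A) (restrict g (fst Y)) = restrict (\<lambda>x. x) (fst Y)"
    using assms by (auto simp: fun_eq_iff compose_def restrict_def)
  ultimately show ?thesis
    by (auto simp: Iso_def intro!: bexI[of _ "(Y, restrict g (fst Y), X)"])
qed

lemma category_S: "category S"
proof
  show "Dom S f \<in> Obj S" "Cod S f \<in> Obj S" if "f \<in> Arr S" for f
    using that by (auto simp: structured_sets_def)
  show "Ide S X \<in> Hom S X X" if "X \<in> Obj S" for X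
    using that by (auto intro!: restrict_Hom_S mor_id)
  show "Comp S g f \<in> Hom S X Z" if "f \<in> Hom S X Y" "g \<in> Hom S Y Z" for f g X Y Z
    using that mor_comp[of X Y Z]
    by (auto simp: mem_Hom_S_iff compose_def mor_restrict PiE_def Pi_def)
  show "Comp S (Ide S Y) f = f" "Comp S f (Ide S X) = f" if "f \<in> Hom S X Y" for f X Y
    using that
    by (auto simp: mem_Hom_S_iff compose_def fun_eq_iff restrict_def PiE_def Pi_def extensional_def)
  show "Comp S (Comp S h g) f = Comp S h (Comp S g f)"
    if "f \<in> Hom S W X" "g \<in> Hom S X Y" "h \<in> Hom S Y Z" for f g h W X Y Z
    using that
    by (auto simp: mem_Hom_S_iff compose_def fun_eq_iff PiE_def Pi_def)
qed

text \<open>Naturality and coherence are equalities of restricted functions and hold by evaluation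
  on nested pairs. The assumptions on \<open>mor\<close> serve to show that the arrows involved, and
  the inverses of the structural ones, exist.\<close>

lemma monoidal_category_S: "monoidal_category S"
proof -
  interpret category S by (rule category_S)
  note extens = compose_def PiE_def Pi_def
  show ?thesis
  proof
    show "Tensor S X Y \<in> Obj S" if "X \<in> Obj S" "Y \<in> Obj S" for X Y
      using that ten_obs by simp
    show "Unit S \<in> Obj S" using I_obs by simp
    show "TensorArr S f g \<in> Hom S (Tensor S X Y) (Tensor S X' Y')"
      if "f \<in> Hom S X X'" "g \<in> Hom S Y Y'" for f g X X' Y Y'
    proof -
      obtain u v where fg: "f = (X, u, X')" "g = (Y, v, Y')"
        and obs: "X \<in> obs" "X' \<in> obs" "Y \<in> obs" "Y' \<in> obs"
        and u: "u \<in> fst X \<rightarrow> fst X'" "mor X X' u" and v: "v \<in> fst Y \<rightarrow> fst Y'" "mor Y Y' v"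
        using \<open>f \<in> _\<close> \<open>g \<in> _\<close> by (auto simp: mem_Hom_S_iff PiE_def)
      have "map_pr u v \<in> cart (fst X) (fst Y) \<rightarrow> cart (fst X') (fst Y')"
        using u v by (auto elim!: cartE)
      then show ?thesis
        using obs u v by (auto simp: fg intro!: restrict_Hom_S mor_ten ten_obs)
    qed
    show "TensorArr S (Ide S X) (Ide S Y) = Ide S (Tensor S X Y)"
      if "X \<in> Obj S" "Y \<in> Obj S" for X Y
      by (auto simp: extens intro!: restrict_ext elim!: cartE)
    show "TensorArr S (Comp S f' f) (Comp S g' g) = Comp S (TensorArr S f' g') (TensorArr S f g)"
      if "f \<in> Hom S X X'" "f' \<in> Hom S X' X''" "g \<in> Hom S Y Y'" "g' \<in> Hom S Y' Y''"
      for f f' g g' X X' X'' Y Y' Y''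
      using that by (auto simp: mem_Hom_S_iff extens intro!: restrict_ext elim!: cartE)
    show "Assoc S X Y Z \<in> Iso S (Tensor S (Tensor S X Y) Z) (Tensor S X (Tensor S Y Z))"
      if "X \<in> Obj S" "Y \<in> Obj S" "Z \<in> Obj S" for X Y Z
      using that mor_assoc mor_coassoc ten_obs
      by (simp, intro restrict_Iso_S[where g = coassoc_map]) (auto elim!: cartE)
    show "LUnit S X \<in> Iso S (Tensor S (Unit S) X) X" if "X \<in> Obj S" for X
      using that mor_lunit mor_colunit ten_obs I_obs
      by (simp, intro restrict_Iso_S[where g = "Pr Star"]) (auto elim!: cartE)
    show "RUnit S X \<in> Iso S (Tensor S X (Unit S)) X" if "X \<in> Obj S" for X
      using that mor_runit mor_corunit ten_obs I_obs
      by (simp, intro restrict_Iso_S[where g = "\<lambda>x. Pr x Star"]) (auto elim!: cartE)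
    show "Comp S (Assoc S X' Y' Z') (TensorArr S (TensorArr S f g) h) =
        Comp S (TensorArr S f (TensorArr S g h)) (Assoc S X Y Z)"
      if "f \<in> Hom S X X'" "g \<in> Hom S Y Y'" "h \<in> Hom S Z Z'" for f g h X X' Y Y' Z Z'
      using that by (auto simp: mem_Hom_S_iff extens intro!: restrict_ext elim!: cartE)
    show "Comp S (LUnit S Y) (TensorArr S (Ide S (Unit S)) f) = Comp S f (LUnit S X)"
      "Comp S (RUnit S Y) (TensorArr S f (Ide S (Unit S))) = Comp S f (RUnit S X)"
      if "f \<in> Hom S X Y" for f X Y
      using that by (auto simp: mem_Hom_S_iff extens intro!: restrict_ext elim!: cartE)
    show "Comp S (TensorArr S (Ide S W) (Assoc S X Y Z))
        (Comp S (Assoc S W (Tensor S X Y) Z) (TensorArr S (Assoc S W X Y) (Ide S Z)))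
      = Comp S (Assoc S W X (Tensor S Y Z)) (Assoc S (Tensor S W X) Y Z)"
      if "W \<in> Obj S" "X \<in> Obj S" "Y \<in> Obj S" "Z \<in> Obj S" for W X Y Z
      by (auto simp: extens intro!: restrict_ext elim!: cartE)
    show "Comp S (TensorArr S (Ide S X) (LUnit S Y)) (Assoc S X (Unit S) Y) =
        TensorArr S (RUnit S X) (Ide S Y)"
      if "X \<in> Obj S" "Y \<in> Obj S" for X Y
      by (auto simp: extens intro!: restrict_ext elim!: cartE)
  qed
qed

end

section \<open>Posets and strict maps\<close>

text \<open>The tensor product written out in \<open>StrPos\<close>, named so that membership and
  elimination rules can be attached to it.\<close>

definition poset_tensor ::
  "('a, 'a univ rel) sobj \<Rightarrow> ('a, 'a univ rel) sobj \<Rightarrow> ('a, 'a univ rel) sobj" where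
  "poset_tensor = (\<lambda>(P, r) (Q, s).
     (cart P Q, {(Pr p q, Pr p' q') | p q p' q'. (p, p') \<in> r \<and> (q, q') \<in> s}))"

lemma StrPos_eq: "StrPos = structured_sets {(P, r). partial_order_on P r} strict_map poset_tensor
    ({Star}, {(Star, Star)})"
  by (simp add: StrPos_def poset_tensor_def)

lemma snd_poset_tensor_iff [simp]:
  "(Pr p q, Pr p' q') \<in> snd (poset_tensor X Y) \<longleftrightarrow> (p, p') \<in> snd X \<and> (q, q') \<in> snd Y"
  by (cases X; cases Y) (auto simp: poset_tensor_def)

lemma snd_poset_tensorE:
  assumes "(z, z') \<in> snd (poset_tensor X Y)"
  obtains p q p' q' where "z = Pr p q" "z' = Pr p' q'" "(p, p') \<in> snd X" "(q, q') \<in> snd Y"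
  using assms by (cases X; cases Y) (auto simp: poset_tensor_def)

lemma fst_poset_tensor [simp]: "fst (poset_tensor X Y) = cart (fst X) (fst Y)"
  by (cases X; cases Y) (simp add: poset_tensor_def)

lemma partial_order_on_singleton: "partial_order_on {x} {(x, x)}"
  by (auto simp: partial_order_on_def preorder_on_def refl_on_def trans_def antisym_def)

lemma partial_order_on_poset_tensor:
  assumes "partial_order_on (fst X) (snd X)" "partial_order_on (fst Y) (snd Y)"
  shows "partial_order_on (cart (fst X) (fst Y)) (snd (poset_tensor X Y))"
proof -
  note r = partial_order_onD[OF assms(1)] and s = partial_order_onD[OF assms(2)]
  let ?t = "snd (poset_tensor X Y)" and ?Z = "cart (fst X) (fst Y)"
  have "?t \<subseteq> ?Z \<times> ?Z"
  proof (rule subrelI)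
    fix z z' assume "(z, z') \<in> ?t"
    then show "(z, z') \<in> ?Z \<times> ?Z"
      by (rule snd_poset_tensorE) (use r(4) s(4) in auto)
  qed
  moreover have "refl_on ?Z ?t"
    using r(1) s(1) by (auto simp: refl_on_def elim!: cartE)
  moreover have "trans ?t"
  proof (rule transI)
    fix x y z assume "(x, y) \<in> ?t" "(y, z) \<in> ?t"
    then show "(x, z) \<in> ?t"
      by (elim snd_poset_tensorE) (auto intro: transD[OF r(2)] transD[OF s(2)])
  qed
  moreover have "antisym ?t"
  proof (rule antisymI)
    fix x y assume "(x, y) \<in> ?t" "(y, x) \<in> ?t"
    then show "x = y"
      by (elim snd_poset_tensorE) (auto intro: antisymD[OF r(3)] antisymD[OF s(3)])
  qed
  ultimately show ?thesis
    by (simp add: partial_order_on_def preorder_on_def)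
qed

lemma strict_mapD: "strict_map X Y f \<Longrightarrow> (x, y) \<in> snd X \<Longrightarrow> x \<noteq> y \<Longrightarrow> (f x, f y) \<in> snd Y \<and> f x \<noteq> f y"
  by (auto simp: strict_map_def strict_part_def)

lemma strict_mapI:
  "(\<And>x y. (x, y) \<in> snd X \<Longrightarrow> x \<noteq> y \<Longrightarrow> (f x, f y) \<in> snd Y \<and> f x \<noteq> f y) \<Longrightarrow> strict_map X Y f"
  by (auto simp: strict_map_def strict_part_def)

text \<open>Strictness settles distinct arguments; for \<open>x = y\<close> the claim is reflexivity
  at \<open>f x\<close>, whence the membership of \<open>f x\<close> in the carrier.\<close>

lemma strict_map_monoD:
  assumes "strict_map X Y f" "partial_order_on (fst Y) (snd Y)" "(x, y) \<in> snd X" "f x \<in> fst Y"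
  shows "(f x, f y) \<in> snd Y"
  using assms strict_mapD[OF assms(1,3)] partial_order_onD(1)[OF assms(2)]
  by (cases "x = y") (auto simp: refl_on_def)

text \<open>The cases follow the order of the assumptions of \<open>set_structure\<close>. The one
  with content is case 8, the tensor product of two strict maps.\<close>

interpretation StrPos: set_structure "{(P, r). partial_order_on P r}" strict_map poset_tensor
  "({Star}, {(Star, Star)})"
proof (unfold_locales, goal_cases)
  case (1 X f g Y)
  \<comment> \<open>A partial order relates only elements of its carrier, so strictness depends on
    the values of the map there alone.\<close>
  have "x \<in> fst X" "y \<in> fst X" if "(x, y) \<in> snd X" for x y
    using that 1(1) partial_order_onD(4)[of "fst X" "snd X"] by auto
  then have "strict_map X Y f \<longleftrightarrow> (\<forall>x \<in> fst X. \<forall>y \<in> fst X. (x, y) \<in> snd X \<longrightarrow> x \<noteq> y \<longrightarrow>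
      (f x, f y) \<in> snd Y \<and> f x \<noteq> f y)" for f
    by (auto simp: strict_map_def strict_part_def)
  then show ?case using 1(2) by simp
next
  case (2 X)
  show ?case by (auto intro: strict_mapI)
next
  case (3 X Y Z f g)
  show ?case by (rule strict_mapI) (use 3(5,6) in \<open>auto dest: strict_mapD\<close>)
next
  case (4 X Y)
  then show ?case
    using partial_order_on_poset_tensor[of X Y] by (simp add: split_beta)
next
  case 6
  show ?case by (simp add: partial_order_on_singleton)
next
  case (8 X X' Y Y' f g)
  have X: "partial_order_on (fst X) (snd X)" "partial_order_on (fst X') (snd X')"
    and Y: "partial_order_on (fst Y) (snd Y)" "partial_order_on (fst Y') (snd Y')"
    using 8(1-4) by auto
  have f: "(f x, f x') \<in> snd X'" if "(x, x') \<in> snd X" for x x'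
    using strict_map_monoD[OF 8(7) X(2) that] partial_order_onD(4)[OF X(1)] that 8(5) by auto
  have g: "(g x, g x') \<in> snd Y'" if "(x, x') \<in> snd Y" for x x'
    using strict_map_monoD[OF 8(8) Y(2) that] partial_order_onD(4)[OF Y(1)] that 8(6) by auto
  show ?case
  proof (rule strict_mapI)
    fix z z' assume zz': "(z, z') \<in> snd (poset_tensor X Y)" and ne: "z \<noteq> z'"
    obtain p q p' q' where z: "z = Pr p q" "z' = Pr p' q'"
      and le: "(p, p') \<in> snd X" "(q, q') \<in> snd Y"
      using zz' by (rule snd_poset_tensorE)
    \<comment> \<open>Distinct pairs differ in some component, where strictness keeps the images
      apart; both components are respected by monotonicity.\<close>
    have "f p \<noteq> f p' \<or> g q \<noteq> g q'"
      using ne z strict_mapD[OF 8(7) le(1)] strict_mapD[OF 8(8) le(2)] by auto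
    then show "(map_pr f g z, map_pr f g z') \<in> snd (poset_tensor X' Y') \<and> map_pr f g z \<noteq> map_pr f g z'"
      using f[OF le(1)] g[OF le(2)] by (auto simp: z)
  qed
next
  case (12 X)
  then show ?case
    by (auto intro!: strict_mapI simp: poset_tensor_def split: prod.splits)
next
  case (14 X)
  then show ?case
    by (auto intro!: strict_mapI simp: poset_tensor_def split: prod.splits)
qed (auto intro!: strict_mapI elim!: snd_poset_tensorE)

section \<open>Finiteness spaces\<close>

lemma perp_anti: "\<U> \<subseteq> \<V> \<Longrightarrow> perp X \<V> \<subseteq> perp X \<U>"
  by (auto simp: perp_def)

lemma perp_perp_ge: "\<U> \<subseteq> Pow X \<Longrightarrow> \<U> \<subseteq> perp X (perp X \<U>)"
  by (auto simp: perp_def Int_commute)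

lemma perp_subset: "perp X \<U> \<subseteq> Pow X"
  by (auto simp: perp_def)

text \<open>\<open>perp\<close> forms an antitone Galois connection with itself, so applying it
  twice is a closure operator.\<close>

lemma finiteness_space_perp_perp: "\<U> \<subseteq> Pow X \<Longrightarrow> finiteness_space (X, perp X (perp X \<U>))"
  unfolding finiteness_space_def prod.case
  by (intro conjI perp_subset equalityI perp_anti perp_perp_ge)

lemma finiteness_space_subset:
  "finiteness_space X \<Longrightarrow> u \<in> snd X \<Longrightarrow> u \<subseteq> fst X"
  by (cases X) (auto simp: finiteness_space_def)

text \<open>Membership is tested by finite intersections with orthogonal sets, and finiteness passes
  to subsets.\<close>

lemma finiteness_space_mono:
  assumes "finiteness_space X" "u \<in> snd X" "w \<subseteq> u"
  shows "w \<in> snd X"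
proof -
  have eq: "perp (fst X) (perp (fst X) (snd X)) = snd X"
    using assms(1) by (auto simp: finiteness_space_def)
  have "finite (w \<inter> u')" if "u' \<in> perp (fst X) (snd X)" for u'
  proof (rule finite_subset)
    show "w \<inter> u' \<subseteq> u' \<inter> u" using assms(3) by auto
    show "finite (u' \<inter> u)" using that assms(2) by (simp add: perp_def)
  qed
  then have "w \<in> perp (fst X) (perp (fst X) (snd X))"
    using assms(3) finiteness_space_subset[OF assms(1,2)] by (auto simp: perp_def)
  then show ?thesis by (simp add: eq)
qed

lemma finiteness_space_memI:
  assumes "finiteness_space X" "u \<subseteq> fst X"
    and "\<And>u'. u' \<in> perp (fst X) (snd X) \<Longrightarrow> finite (u \<inter> u')"
  shows "u \<in> snd X"
proof -
  have "u \<in> perp (fst X) (perp (fst X) (snd X))"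
    using assms(2,3) by (auto simp: perp_def)
  then show ?thesis using assms(1) by (auto simp: finiteness_space_def)
qed

text \<open>The preimage condition is traded for finite fibres, which are easier to check.
  Singletons are orthogonal to everything and so force finite fibres. Conversely, the part of
  \<open>u\<close> over \<open>v'\<close> is a union of fibres indexed by the finite intersection of
  \<open>v'\<close> with the image of \<open>u\<close>.\<close>

lemma finiteness_map_iff:
  assumes "finiteness_space Y"
  shows "finiteness_map X Y f \<longleftrightarrow>
    (\<forall>u \<in> snd X. f ` u \<in> snd Y \<and> (\<forall>y. finite {x \<in> u \<inter> fst X. f x = y}))"
    (is "_ \<longleftrightarrow> ?R")
proof
  assume f: "finiteness_map X Y f"
  have "finite {x \<in> u \<inter> fst X. f x = y}" if "u \<in> snd X" for u y
  proof (cases "y \<in> f ` u")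
    case True
    then have "{y} \<in> perp (fst Y) (snd Y)"
      using f that finiteness_space_subset[OF assms, of "f ` u"]
      by (auto simp: finiteness_map_def perp_def split: prod.splits)
    then have "finite (f -` {y} \<inter> fst X \<inter> u)"
      using f that by (auto simp: finiteness_map_def perp_def split: prod.splits)
    then show ?thesis by (rule rev_finite_subset) auto
  next
    case False
    then have "{x \<in> u \<inter> fst X. f x = y} = {}" by auto
    then show ?thesis by (simp only: finite.emptyI)
  qed
  then show ?R using f by (auto simp: finiteness_map_def split: prod.splits)
next
  assume ?R
  moreover have "finite (f -` v' \<inter> fst X \<inter> u)" if "v' \<in> perp (fst Y) (snd Y)" "u \<in> snd X" for v' u
  proof (rule finite_subset)
    show "f -` v' \<inter> fst X \<inter> u \<subseteq> (\<Union>y \<in> v' \<inter> f ` u. {x \<in> u \<inter> fst X. f x = y})" by auto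
    show "finite \<dots>" using \<open>?R\<close> that by (auto simp: perp_def)
  qed
  ultimately show "finiteness_map X Y f"
    by (auto simp: finiteness_map_def perp_def split: prod.splits)
qed

text \<open>Fibres of an injective map have at most one point, so only the condition on images
  remains. This covers the structural isomorphisms and their inverses.\<close>

lemma finiteness_map_injI:
  assumes "finiteness_space Y" "inj_on f (fst X)" "\<And>u. u \<in> snd X \<Longrightarrow> f ` u \<in> snd Y"
  shows "finiteness_map X Y f"
proof -
  have "finite {x \<in> u \<inter> fst X. f x = y}" for u y
    by (rule finite_subset[OF _ finite_vimage_IntI[of "{y}" f "fst X"]]) (use assms(2) in auto)
  then show ?thesis using assms by (auto simp: finiteness_map_iff)
qed

section \<open>Tensor products of finiteness spaces\<close>

definition finiteness_tensor :: "('a, 'a univ set set) sobj \<Rightarrow> ('a, 'a univ set set) sobj \<Rightarrow>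
    ('a, 'a univ set set) sobj" where
  "finiteness_tensor = (\<lambda>(X, \<U>) (Y, \<V>). (cart X Y,
     perp (cart X Y) (perp (cart X Y) {cart u v | u v. u \<in> \<U> \<and> v \<in> \<V>})))"

lemma FinF_eq:
  "FinF = structured_sets {X. finiteness_space X} finiteness_map finiteness_tensor ({Star}, Pow {Star})"
  by (simp add: FinF_def finiteness_tensor_def)

lemma fst_finiteness_tensor [simp]: "fst (finiteness_tensor X Y) = cart (fst X) (fst Y)"
  by (cases X; cases Y) (simp add: finiteness_tensor_def)

lemma finiteness_space_tensor:
  "finiteness_space X \<Longrightarrow> finiteness_space Y \<Longrightarrow> finiteness_space (finiteness_tensor X Y)"
  by (cases X; cases Y)
    (force simp: finiteness_tensor_def intro!: finiteness_space_perp_perp elim!: cartE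
      dest: finiteness_space_subset)

lemma finite_cart: "finite A \<Longrightarrow> finite B \<Longrightarrow> finite (cart A B)"
  by (rule finite_subset[of _ "(\<lambda>(a, b). Pr a b) ` (A \<times> B)"]) (auto elim!: cartE)

text \<open>If \<open>f ` w\<close> met some \<open>u' \<in> \<U>\<^sup>\<bottom>\<close> in an infinite set, a choice of one point of \<open>w\<close> above each
  element of that set would be orthogonal to \<open>\<R>\<close> and yet have infinite intersection with \<open>w\<close>.\<close>

lemma image_perp_perp_mem:
  assumes X: "finiteness_space X" and w: "w \<in> perp Z (perp Z \<R>)"
    and f: "f ` Z \<subseteq> fst X" "\<And>\<rho>. \<rho> \<in> \<R> \<Longrightarrow> f ` \<rho> \<in> snd X"
  shows "f ` w \<in> snd X"
proof (rule finiteness_space_memI[OF X])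
  have wsub: "w \<subseteq> Z" using w by (simp add: perp_def)
  then show "f ` w \<subseteq> fst X" using f by auto
  fix u' assume u': "u' \<in> perp (fst X) (snd X)"
  define G where "G = inv_into w f ` (f ` w \<inter> u')"
  have Gw: "G \<subseteq> w" by (auto simp: G_def inv_into_into)
  have "finite (G \<inter> \<rho>)" if "\<rho> \<in> \<R>" for \<rho>
  proof (rule finite_subset)
    \<comment> \<open>A point of \<open>G\<close> is the chosen preimage of its own image, and for
      points of \<open>\<rho>\<close> that image lies in the finite intersection of
      \<open>u'\<close> with the image of \<open>\<rho>\<close>.\<close>
    show "G \<inter> \<rho> \<subseteq> inv_into w f ` (u' \<inter> f ` \<rho>)"
    proof
      fix z assume z: "z \<in> G \<inter> \<rho>"
      then obtain x where x: "x \<in> f ` w" "x \<in> u'" "z = inv_into w f x" by (auto simp: G_def)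
      then have "f z = x" by (simp add: f_inv_into_f)
      then have "x \<in> u' \<inter> f ` \<rho>" using z x by blast
      then show "z \<in> inv_into w f ` (u' \<inter> f ` \<rho>)" using x by blast
    qed
    show "finite (inv_into w f ` (u' \<inter> f ` \<rho>))" using u' f(2)[OF that] by (auto simp: perp_def)
  qed
  then have "G \<in> perp Z \<R>"
    using Gw wsub by (auto simp: perp_def)
  then have "finite (w \<inter> G)" using w by (auto simp: perp_def)
  then have "finite (f ` G)" using Gw by (simp add: Int_absorb1)
  moreover have "f ` w \<inter> u' \<subseteq> f ` G"
  proof
    fix x assume x: "x \<in> f ` w \<inter> u'"
    then have "x = f (inv_into w f x)" by (simp add: f_inv_into_f)
    then show "x \<in> f ` G" using x unfolding G_def by blast
  qed
  ultimately show "finite (f ` w \<inter> u')" by (rule rev_finite_subset)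
qed

text \<open>The projections send a generator \<open>cart u v\<close> into \<open>u\<close> and
  \<open>v\<close>, so \<open>image_perp_perp_mem\<close> applies to them. Conversely,
  \<open>w\<close> lies inside the generator formed by its own two projections. This amounts to the
  description of the tensor product by subsets of products \<open>u \<times> v\<close>.\<close>

lemma finiteness_tensor_iff:
  assumes X: "finiteness_space X" and Y: "finiteness_space Y"
  shows "w \<in> snd (finiteness_tensor X Y) \<longleftrightarrow>
    w \<subseteq> cart (fst X) (fst Y) \<and> left ` w \<in> snd X \<and> right ` w \<in> snd Y"
    (is "_ \<longleftrightarrow> ?R")
proof
  assume w: "w \<in> snd (finiteness_tensor X Y)"
  then have w': "w \<in> perp (cart (fst X) (fst Y)) (perp (cart (fst X) (fst Y))
      {cart u v | u v. u \<in> snd X \<and> v \<in> snd Y})"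
    by (cases X; cases Y) (simp add: finiteness_tensor_def)
  \<comment> \<open>Only inclusions hold, as \<open>cart u v\<close> is empty if either factor is;
    closure under subsets makes up for this.\<close>
  have l: "left ` cart u v \<subseteq> u" and r: "right ` cart u v \<subseteq> v" for u v :: "'a univ set"
    by (auto elim!: cartE)
  have "left ` w \<in> snd X"
    by (rule image_perp_perp_mem[OF X w' l]) (auto intro: finiteness_space_mono[OF X _ l])
  moreover have "right ` w \<in> snd Y"
    by (rule image_perp_perp_mem[OF Y w' r]) (auto intro: finiteness_space_mono[OF Y _ r])
  ultimately show ?R
    using finiteness_space_subset[OF finiteness_space_tensor[OF X Y] w] by auto
next
  assume w: ?R
  let ?R = "{cart u v | u v. u \<in> snd X \<and> v \<in> snd Y}"
  have "cart (left ` w) (right ` w) \<in> ?R" using w by auto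
  moreover have "w \<subseteq> cart (left ` w) (right ` w)" using w by (force elim!: cartE)
  ultimately have "finite (w \<inter> u')" if "u' \<in> perp (cart (fst X) (fst Y)) ?R" for u'
    using that
    by (intro finite_subset[of "w \<inter> u'" "u' \<inter> cart (left ` w) (right ` w)"]) (blast, simp add: perp_def)
  then have "w \<in> perp (cart (fst X) (fst Y)) (perp (cart (fst X) (fst Y)) ?R)"
    using w by (simp add: perp_def)
  then show "w \<in> snd (finiteness_tensor X Y)"
    by (cases X; cases Y) (simp add: finiteness_tensor_def)
qed

lemma finiteness_space_singleton: "finiteness_space ({x}, Pow {x})"
proof -
  have "finite (A \<inter> B)" if "A \<subseteq> {x}" for A B :: "'a set"
    using that by (meson finite.simps finite_Int finite_subset)
  then show ?thesis by (auto simp: finiteness_space_def perp_def)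
qed

text \<open>By \<open>finiteness_tensor_iff\<close>, conditions on subsets of a tensor product are
  read off from their projections.\<close>

interpretation FinF: set_structure "{X. finiteness_space X}" finiteness_map finiteness_tensor
  "({Star}, Pow {Star})"
proof (unfold_locales, goal_cases)
  case (1 X f g Y)
  have "f ` u = g ` u" if "u \<in> snd X" for u
    using 1 that finiteness_space_subset[of X u] by (intro image_cong) auto
  moreover have "f -` v' \<inter> fst X = g -` v' \<inter> fst X" for v' using 1 by auto
  ultimately show ?case by (auto simp: finiteness_map_def split: prod.splits)
next
  case (2 X)
  then show ?case by (auto intro!: finiteness_map_injI)
next
  case (3 X Y Z f g)
  \<comment> \<open>Since \<open>f\<close> maps into \<open>fst Y\<close>, the inner preimage may be
    cut down to \<open>fst Y\<close>; this is the set that the condition on \<open>g\<close> yields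
    and the one on \<open>f\<close> accepts.\<close>
  have "(\<lambda>x. g (f x)) -` v' \<inter> fst X = f -` (g -` v' \<inter> fst Y) \<inter> fst X" for v'
    using 3(4) by auto
  moreover have "(\<lambda>x. g (f x)) ` u = g ` f ` u" for u by auto
  ultimately show ?case
    using 3(5,6) by (simp add: finiteness_map_def split_beta del: vimage_Int)
next
  case (4 X Y)
  then show ?case by (simp add: finiteness_space_tensor)
next
  case 6
  show ?case by (simp add: finiteness_space_singleton)
next
  case (8 X X' Y Y' f g)
  have X: "finiteness_space X" "finiteness_space X'" and Y: "finiteness_space Y" "finiteness_space Y'"
    using 8(1-4) by auto
  have f: "f ` u \<in> snd X'" "finite {x \<in> u \<inter> fst X. f x = y}" if "u \<in> snd X" for u y
    using 8(7) that by (auto simp: finiteness_map_iff X)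
  have g: "g ` v \<in> snd Y'" "finite {x \<in> v \<inter> fst Y. g x = y}" if "v \<in> snd Y" for v y
    using 8(8) that by (auto simp: finiteness_map_iff Y)
  have "map_pr f g ` w \<in> snd (finiteness_tensor X' Y') \<and>
      finite {p \<in> w \<inter> fst (finiteness_tensor X Y). map_pr f g p = q}"
    if "w \<in> snd (finiteness_tensor X Y)" for w q
  proof
    have w: "w \<subseteq> cart (fst X) (fst Y)" "left ` w \<in> snd X" "right ` w \<in> snd Y"
      using that by (auto simp: finiteness_tensor_iff X Y)
    have "map_pr f g ` w \<subseteq> cart (fst X') (fst Y')"
      using 8(5,6) by (auto elim!: cartE dest!: subsetD[OF w(1)])
    moreover have "left ` map_pr f g ` w = f ` left ` w" "right ` map_pr f g ` w = g ` right ` w"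
      by (simp_all add: image_image)
    ultimately show "map_pr f g ` w \<in> snd (finiteness_tensor X' Y')"
      using f(1) g(1) w by (simp add: finiteness_tensor_iff X Y)
    \<comment> \<open>A fibre of the product map sits in the product of fibres of \<open>f\<close>
      and \<open>g\<close> over the projections of \<open>w\<close>.\<close>
    have "{p \<in> w \<inter> fst (finiteness_tensor X Y). map_pr f g p = q} \<subseteq>
        cart {x \<in> left ` w \<inter> fst X. f x = left q} {x \<in> right ` w \<inter> fst Y. g x = right q}"
      by (force elim!: cartE)
    then show "finite {p \<in> w \<inter> fst (finiteness_tensor X Y). map_pr f g p = q}"
      by (rule finite_subset) (intro finite_cart f(2) g(2) w(2,3))
  qed
  then show ?case using X Y by (simp add: finiteness_map_iff finiteness_space_tensor)
next
  case (9 X Y Z)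
  then have sp: "finiteness_space X" "finiteness_space Y" "finiteness_space Z" by auto
  show ?case
  proof (rule finiteness_map_injI)
    fix w assume w: "w \<in> snd (finiteness_tensor (finiteness_tensor X Y) Z)"
    then have "w \<subseteq> cart (cart (fst X) (fst Y)) (fst Z)"
      by (simp add: finiteness_tensor_iff finiteness_space_tensor sp)
    then have "assoc_map ` w \<subseteq> cart (fst X) (cart (fst Y) (fst Z))"
      "right ` assoc_map ` w \<subseteq> cart (fst Y) (fst Z)"
      by (auto elim!: cartE)
    then show "assoc_map ` w \<in> snd (finiteness_tensor X (finiteness_tensor Y Z))"
      using w by (simp add: finiteness_tensor_iff finiteness_space_tensor sp image_image)
  qed (auto simp: sp finiteness_space_tensor inj_on_def elim!: cartE)
next
  case (10 X Y Z)
  then have sp: "finiteness_space X" "finiteness_space Y" "finiteness_space Z" by auto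
  show ?case
  proof (rule finiteness_map_injI)
    fix w assume w: "w \<in> snd (finiteness_tensor X (finiteness_tensor Y Z))"
    then have "w \<subseteq> cart (fst X) (cart (fst Y) (fst Z))"
      by (simp add: finiteness_tensor_iff finiteness_space_tensor sp)
    then have "coassoc_map ` w \<subseteq> cart (cart (fst X) (fst Y)) (fst Z)"
      "left ` coassoc_map ` w \<subseteq> cart (fst X) (fst Y)"
      by (auto elim!: cartE)
    then show "coassoc_map ` w \<in> snd (finiteness_tensor (finiteness_tensor X Y) Z)"
      using w by (simp add: finiteness_tensor_iff finiteness_space_tensor sp image_image)
  qed (auto simp: sp finiteness_space_tensor inj_on_def elim!: cartE)
next
  case (11 X)
  then show ?case
    by (intro finiteness_map_injI) (auto simp: finiteness_tensor_iff finiteness_space_singleton inj_on_def elim!: cartE)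
next
  case (12 X)
  then show ?case
    by (intro finiteness_map_injI)
      (auto simp: finiteness_tensor_iff finiteness_space_tensor finiteness_space_singleton inj_on_def image_image
        dest: subsetD[OF finiteness_space_subset])
next
  case (13 X)
  then show ?case
    by (intro finiteness_map_injI) (auto simp: finiteness_tensor_iff finiteness_space_singleton inj_on_def elim!: cartE)
next
  case (14 X)
  then show ?case
    by (intro finiteness_map_injI)
      (auto simp: finiteness_tensor_iff finiteness_space_tensor finiteness_space_singleton inj_on_def image_image
        dest: subsetD[OF finiteness_space_subset])
qed simp_all

section \<open>Artinian and narrow subsets\<close>

text \<open>Forwards, narrowness makes the set of minimal values of a sequence finite and the
  artinian property puts one of them below every value. Backwards, an infinite descending chain and
  an enumeration of an infinite antichain are both sequences without an ascending pair.\<close>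

lemma artinian_narrow_iff:
  assumes r: "partial_order_on P r" and A: "A \<subseteq> P"
  shows "artinian (A, Restr r A) \<and> narrow (A, Restr r A) \<longleftrightarrow>
    (\<forall>s :: nat \<Rightarrow> _. range s \<subseteq> A \<longrightarrow> (\<exists>i j. i < j \<and> (s i, s j) \<in> r))"
    (is "?L \<longleftrightarrow> ?R")
proof
  note po = partial_order_onD[OF r]
  assume ?L
  show ?R
  proof (intro allI impI)
    fix s :: "nat \<Rightarrow> _" assume s: "range s \<subseteq> A"
    let ?lt = "strict_part (Restr r A)"
    have "wf ?lt"
      unfolding wf_iff_no_infinite_down_chain
    proof
      assume "\<exists>c. \<forall>i. (c (Suc i), c i) \<in> ?lt"
      then obtain c where c: "\<And>i. (c (Suc i), c i) \<in> ?lt" by blast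
      then have "c i \<in> A" for i using c[of i] by (simp add: strict_part_def)
      then show False using \<open>?L\<close> c unfolding artinian_def prod.case by blast
    qed
    define M where "M = {x \<in> range s. \<forall>y. (y, x) \<in> ?lt \<longrightarrow> y \<notin> range s}"
    have sub: "M \<subseteq> range s" by (auto simp: M_def)
    have "\<forall>x\<in>M. \<forall>y\<in>M. x \<noteq> y \<longrightarrow> (x, y) \<notin> Restr r A \<and> (y, x) \<notin> Restr r A"
      by (auto simp: M_def strict_part_def)
    moreover have "M \<subseteq> A" using sub s by (rule subset_trans)
    ultimately have "finite M"
      using \<open>?L\<close> unfolding narrow_def prod.case by blast
    moreover note sub
    \<comment> \<open>A minimal value may recur infinitely often, so \<open>I\<close> only collects
      enough indices to hit each of them.\<close>
    ultimately obtain I where I: "finite I" "M = s ` I"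
      by (meson finite_subset_image)
    obtain n where n: "\<And>i. i \<in> I \<Longrightarrow> i < n"
      using I(1) by (auto simp: finite_nat_set_iff_bounded)
    txt \<open>Beyond the last index \<open>n\<close> of a minimal value, every value lies above an earlier, minimal one.\<close>
    let ?Q = "{x \<in> range s. (x, s n) \<in> r}"
    have "s n \<in> P" using A s by auto
    then have "s n \<in> ?Q" using po(1) by (auto simp: refl_on_def)
    then obtain z where z: "z \<in> ?Q" "\<And>y. (y, z) \<in> ?lt \<Longrightarrow> y \<notin> ?Q"
      using wfE_min[OF \<open>wf ?lt\<close>, of _ ?Q] by blast
    \<comment> \<open>By transitivity \<open>?Q\<close> is downward closed in the range, so its
      minimal element \<open>z\<close> is minimal in the whole range.\<close>
    have "(y, s n) \<in> r" if "(y, z) \<in> ?lt" for y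
      using that z(1) transD[OF po(2), of y z "s n"] by (simp add: strict_part_def)
    then have "z \<in> M"
      using z unfolding M_def by blast
    then obtain i where "i \<in> I" "z = s i" using I(2) by auto
    then show "\<exists>i j. i < j \<and> (s i, s j) \<in> r" using z(1) n by auto
  qed
next
  note po = partial_order_onD[OF r]
  assume R: ?R
  show ?L
  proof
    show "artinian (A, Restr r A)"
    proof -
      have False if s: "\<forall>n. s n \<in> A \<and> (s (Suc n), s n) \<in> strict_part (Restr r A)" for s :: "nat \<Rightarrow> _"
      proof -
        \<comment> \<open>Descent between neighbours extends to every gap \<open>k + 1\<close>,
          antisymmetry keeping it strict. The choice \<open>k = j - Suc i\<close> then rules out an
          ascending pair at \<open>i < j\<close>.\<close>
        have le: "(s (Suc (i + k)), s i) \<in> r \<and> s (Suc (i + k)) \<noteq> s i" for i k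
        proof (induction k)
          case 0
          show ?case using s by (auto simp: strict_part_def)
        next
          case (Suc k)
          have "(s (Suc (i + Suc k)), s (Suc (i + k))) \<in> r" "s (Suc (i + Suc k)) \<noteq> s (Suc (i + k))"
            using s by (auto simp: strict_part_def)
          then show ?case
            using Suc.IH transD[OF po(2), of "s (Suc (i + Suc k))" "s (Suc (i + k))" "s i"]
              antisymD[OF po(3), of "s (Suc (i + k))" "s i"] by auto
        qed
        have "range s \<subseteq> A" using s by auto
        then obtain i j where "i < j" "(s i, s j) \<in> r" using R by blast
        then show False
          using le[of i "j - Suc i"] antisymD[OF po(3), of "s i" "s j"] by simp
      qed
      then show ?thesis unfolding artinian_def prod.case by blast
    qed
    show "narrow (A, Restr r A)"
    proof -
      have False if B: "B \<subseteq> A" "infinite B"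
        "\<forall>x\<in>B. \<forall>y\<in>B. x \<noteq> y \<longrightarrow> (x, y) \<notin> Restr r A" for B
      proof -
        obtain s :: "nat \<Rightarrow> _" where s: "inj s" "range s \<subseteq> B"
          using infinite_countable_subset[OF B(2)] by auto
        moreover have "range s \<subseteq> A" using s(2) B(1) by (rule subset_trans)
        ultimately obtain i j where "i < j" "(s i, s j) \<in> r" using R by blast
        moreover have "s i \<noteq> s j" using s(1) \<open>i < j\<close> by (auto dest: injD)
        moreover have "s i \<in> B" "s j \<in> B" using s(2) by auto
        ultimately show False using B(1) B(3)[rule_format, of "s i" "s j"] by auto
      qed
      then show ?thesis unfolding narrow_def prod.case by blast
    qed
  qed
qed

section \<open>The finiteness space of a poset, strict maps and products\<close>

lemma fst_E_obj [simp]: "fst (E_obj X) = fst X"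
  by (cases X) (simp add: E_obj_def)

lemma snd_E_obj_iff:
  assumes "partial_order_on (fst X) (snd X)"
  shows "A \<in> snd (E_obj X) \<longleftrightarrow>
    A \<subseteq> fst X \<and> (\<forall>s :: nat \<Rightarrow> _. range s \<subseteq> A \<longrightarrow> (\<exists>i j. i < j \<and> (s i, s j) \<in> snd X))"
  using artinian_narrow_iff[OF assms] by (cases X) (auto simp: E_obj_def)

lemma E_objD:
  fixes s :: "nat \<Rightarrow> _"
  assumes "partial_order_on (fst X) (snd X)" "A \<in> snd (E_obj X)" "\<And>n. s n \<in> A"
  obtains i j where "i < j" "(s i, s j) \<in> snd X"
proof -
  have "range s \<subseteq> A" using assms(3) by auto
  then show thesis using assms(2) that unfolding snd_E_obj_iff[OF assms(1)] by blast
qed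

lemma finiteness_space_E_obj:
  assumes X: "partial_order_on (fst X) (snd X)"
  shows "finiteness_space (E_obj X)"
proof -
  let ?U = "snd (E_obj X)"
  have U: "?U \<subseteq> Pow (fst X)" using X by (auto simp: snd_E_obj_iff)
  have "A \<in> ?U" if A: "A \<in> perp (fst X) (perp (fst X) ?U)" for A
  proof (rule ccontr)
    assume "A \<notin> ?U"
    moreover have AX: "A \<subseteq> fst X" using A by (simp add: perp_def)
    ultimately obtain s :: "nat \<Rightarrow> _" where s: "range s \<subseteq> A" "\<And>i j. i < j \<Longrightarrow> (s i, s j) \<notin> snd X"
      using X by (auto simp: snd_E_obj_iff)
    \<comment> \<open>A repeated value would be an ascending pair by reflexivity. Injectivity makes
      the range infinite.\<close>
    have "inj s"
    proof (rule linorder_inj_onI')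
      fix i j :: nat assume "i < j"
      then show "s i \<noteq> s j"
        using s AX partial_order_onD(1)[OF X] by (metis refl_onD rangeI subsetD)
    qed
    have "finite (range s \<inter> u)" if u: "u \<in> ?U" for u
    proof (rule ccontr)
      assume "infinite (range s \<inter> u)"
      \<comment> \<open>The indices with values in \<open>u\<close> enumerate a subsequence inside
        \<open>u\<close>, and an ascending pair of it is one of \<open>s\<close>.\<close>
      then have J: "infinite (s -` u)" by (metis Int_commute finite_imageI image_vimage_eq)
      obtain i j where "i < j" "(s (enumerate (s -` u) i), s (enumerate (s -` u) j)) \<in> snd X"
        by (rule E_objD[OF X u, of "\<lambda>n. s (enumerate (s -` u) n)"]) (use enumerate_in_set[OF J] in auto)
      then show False using s(2) enumerate_mono[OF _ J] by blast
    qed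
    then have "range s \<in> perp (fst X) ?U" using s(1) AX by (auto simp: perp_def)
    then have "finite (A \<inter> range s)" using A by (simp add: perp_def)
    then show False using s(1) \<open>inj s\<close> by (simp add: Int_absorb1 finite_image_iff)
  qed
  then have "perp (fst X) (perp (fst X) ?U) = ?U" using perp_perp_ge[OF U] by auto
  then show ?thesis using U by (simp add: finiteness_space_def split_beta)
qed

text \<open>For images, a sequence in the image of \<open>u\<close> lifts to \<open>u\<close>, and
  monotonicity carries an ascending pair back. For fibres, an injective sequence in an infinite
  fibre would have an ascending pair of distinct points with equal images, against
  strictness.\<close>

lemma finiteness_map_E_obj:
  assumes X: "partial_order_on (fst X) (snd X)" and Y: "partial_order_on (fst Y) (snd Y)"
    and f: "f \<in> fst X \<rightarrow> fst Y" "strict_map X Y f"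
  shows "finiteness_map (E_obj X) (E_obj Y) f"
proof -
  have "f ` u \<in> snd (E_obj Y) \<and> finite {x \<in> u \<inter> fst X. f x = y}" if u: "u \<in> snd (E_obj X)" for u y
  proof
    have uX: "u \<subseteq> fst X" using u X by (simp add: snd_E_obj_iff)
    have "\<exists>i j. i < j \<and> (s i, s j) \<in> snd Y" if s: "range s \<subseteq> f ` u" for s :: "nat \<Rightarrow> _"
    proof -
      have "\<forall>n. \<exists>x \<in> u. s n = f x" using s by blast
      then obtain t where t: "\<And>n. t n \<in> u" "\<And>n. s n = f (t n)" by metis
      obtain i j where "i < j" "(t i, t j) \<in> snd X" by (rule E_objD[OF X u t(1)])
      moreover have "f (t i) \<in> fst Y" using f(1) uX t(1) by blast
      ultimately have "(s i, s j) \<in> snd Y" using strict_map_monoD[OF f(2) Y] by (simp add: t(2))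
      then show ?thesis using \<open>i < j\<close> by blast
    qed
    moreover have "f ` u \<subseteq> fst Y" using f(1) uX by blast
    ultimately show "f ` u \<in> snd (E_obj Y)" unfolding snd_E_obj_iff[OF Y] by blast
    show "finite {x \<in> u \<inter> fst X. f x = y}"
    proof (rule ccontr)
      assume "infinite {x \<in> u \<inter> fst X. f x = y}"
      then obtain s :: "nat \<Rightarrow> _" where s: "inj s" "range s \<subseteq> {x \<in> u \<inter> fst X. f x = y}"
        using infinite_countable_subset by blast
      then have s': "s n \<in> u" "f (s n) = y" for n by auto
      obtain i j where "i < j" "(s i, s j) \<in> snd X" by (rule E_objD[OF X u s'(1)])
      moreover have "s i \<noteq> s j" using \<open>i < j\<close> s(1) by (simp add: inj_eq)
      ultimately have "f (s i) \<noteq> f (s j)" using strict_mapD[OF f(2)] by blast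
      then show False by (simp add: s'(2))
    qed
  qed
  then show ?thesis using Y by (simp add: finiteness_map_iff finiteness_space_E_obj)
qed

text \<open>Pairs of indices are coloured by whether the earlier term lies below the later one; an
  infinite homogeneous set cannot have the negative colour, as the sequence along it has an
  ascending pair.\<close>

lemma E_obj_ascending_subseq:
  fixes s :: "nat \<Rightarrow> _"
  assumes X: "partial_order_on (fst X) (snd X)" and A: "A \<in> snd (E_obj X)" and s: "\<And>n. s n \<in> A"
  obtains g :: "nat \<Rightarrow> nat" where "strict_mono g" "\<And>i j. i < j \<Longrightarrow> (s (g i), s (g j)) \<in> snd X"
proof -
  \<comment> \<open>Colourings live on two-element sets, so \<open>Min\<close> and
    \<open>Max\<close> recover the order of the indices; colour 0 means ascending.\<close>
  define c :: "nat set \<Rightarrow> nat" where "c e = (if (s (Min e), s (Max e)) \<in> snd X then 0 else 1)" for e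
  obtain K t where K: "infinite K" and t: "\<And>i j. i \<in> K \<Longrightarrow> j \<in> K \<Longrightarrow> i \<noteq> j \<Longrightarrow> c {i, j} = t"
  proof -
    have "c {i, j} < 2" for i j by (simp add: c_def)
    then show thesis using Ramsey2[of "UNIV :: nat set" c 2] that by auto
  qed
  let ?g = "enumerate K"
  have g: "?g i < ?g j" "c {?g i, ?g j} = t" if "i < j" for i j
    using enumerate_mono[OF that K] t enumerate_in_set[OF K] by auto
  then have c: "(s (?g i), s (?g j)) \<in> snd X \<longleftrightarrow> t = 0" if "i < j" for i j
    using g[OF that] by (auto simp: c_def less_imp_le split: if_splits)
  obtain i j where "i < j" "(s (?g i), s (?g j)) \<in> snd X"
    by (rule E_objD[OF X A, of "\<lambda>n. s (?g n)"]) (use s in auto)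
  then have "t = 0" using c by simp
  then show thesis using g(1) c by (intro that[of ?g]) (auto simp: strict_mono_def)
qed

text \<open>By \<open>finiteness_tensor_iff\<close> it remains to compare \<open>A\<close> with its
  projections. Sequences in a projection lift to \<open>A\<close>, and the projections are monotone.
  Conversely, an ascending subsequence of first components contains an ascending pair of second
  components.\<close>

lemma E_obj_tensor:
  assumes X: "partial_order_on (fst X) (snd X)" and Y: "partial_order_on (fst Y) (snd Y)"
  shows "E_obj (poset_tensor X Y) = finiteness_tensor (E_obj X) (E_obj Y)"
proof (rule prod_eqI)
  have XY: "partial_order_on (fst (poset_tensor X Y)) (snd (poset_tensor X Y))"
    using partial_order_on_poset_tensor[OF X Y] by simp
  have "A \<in> snd (E_obj (poset_tensor X Y)) \<longleftrightarrow>
    A \<subseteq> cart (fst X) (fst Y) \<and> left ` A \<in> snd (E_obj X) \<and> right ` A \<in> snd (E_obj Y)" (is "?L \<longleftrightarrow> ?R")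
    for A
  proof
    assume A: ?L
    then have sub: "A \<subseteq> cart (fst X) (fst Y)" using XY by (simp add: snd_E_obj_iff)
    have proj: "(left z, left z') \<in> snd X" "(right z, right z') \<in> snd Y"
      if "(z, z') \<in> snd (poset_tensor X Y)" for z z'
      by (rule snd_poset_tensorE[OF that], simp)+
    \<comment> \<open>Stated for any \<open>f\<close> so as to serve both projections.\<close>
    have lift: "\<exists>i j z z'. i < j \<and> s i = f z \<and> s j = f z' \<and> (z, z') \<in> snd (poset_tensor X Y)"
      if "range s \<subseteq> f ` A" for s :: "nat \<Rightarrow> 'a univ" and f
    proof -
      have "\<forall>n. \<exists>x \<in> A. s n = f x" using that by blast
      then obtain t where t: "\<And>n. t n \<in> A" "\<And>n. s n = f (t n)" by metis
      obtain i j where "i < j" "(t i, t j) \<in> snd (poset_tensor X Y)"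
        by (rule E_objD[OF XY A t(1)])
      then have "s i = f (t i) \<and> s j = f (t j)" using t(2) by blast
      then show ?thesis using \<open>i < j\<close> \<open>(t i, t j) \<in> _\<close> by blast
    qed
    have "\<exists>i j. i < j \<and> (s i, s j) \<in> snd X" if s: "range s \<subseteq> left ` A" for s :: "nat \<Rightarrow> _"
    proof -
      obtain i j z z' where "i < j" "s i = left z" "s j = left z'" "(z, z') \<in> snd (poset_tensor X Y)"
        using lift[OF s] by blast
      then have "i < j \<and> (s i, s j) \<in> snd X" by (simp add: proj(1))
      then show ?thesis by blast
    qed
    moreover have "\<exists>i j. i < j \<and> (s i, s j) \<in> snd Y" if s: "range s \<subseteq> right ` A" for s :: "nat \<Rightarrow> _"
    proof -
      obtain i j z z' where "i < j" "s i = right z" "s j = right z'" "(z, z') \<in> snd (poset_tensor X Y)"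
        using lift[OF s] by blast
      then have "i < j \<and> (s i, s j) \<in> snd Y" by (simp add: proj(2))
      then show ?thesis by blast
    qed
    moreover have "left ` A \<subseteq> fst X" "right ` A \<subseteq> fst Y" using sub by (auto elim!: cartE)
    ultimately show ?R using sub unfolding snd_E_obj_iff[OF X] snd_E_obj_iff[OF Y] by blast
  next
    assume R: ?R
    have "\<exists>i j. i < j \<and> (s i, s j) \<in> snd (poset_tensor X Y)" if s: "range s \<subseteq> A" for s :: "nat \<Rightarrow> _"
    proof -
      have l: "left (s n) \<in> left ` A" and r: "right (s n) \<in> right ` A" for n using s by (simp_all add: range_subsetD)
      have eq: "Pr (left (s n)) (right (s n)) = s n" for n
      proof -
        have "s n \<in> cart (fst X) (fst Y)" using s R by blast
        then show ?thesis by (rule cartE) simp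
      qed
      have lA: "left ` A \<in> snd (E_obj X)" using R by simp
      obtain g :: "nat \<Rightarrow> nat"
        where g: "strict_mono g" "\<And>i j. i < j \<Longrightarrow> (left (s (g i)), left (s (g j))) \<in> snd X"
        using E_obj_ascending_subseq[OF X lA, of "\<lambda>n. left (s n)", OF l] by blast
      \<comment> \<open>Along \<open>g\<close> the first components ascend at every pair of indices,
        so any pair that ascends in the second component ascends in the product.\<close>
      obtain i j where ij: "i < j" "(right (s (g i)), right (s (g j))) \<in> snd Y"
        by (rule E_objD[OF Y, of "right ` A" "\<lambda>n. right (s (g n))"]) (use R r in auto)
      have "(Pr (left (s (g i))) (right (s (g i))), Pr (left (s (g j))) (right (s (g j))))
          \<in> snd (poset_tensor X Y)"
        using ij(2) g(2)[OF ij(1)] by simp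
      then have "(s (g i), s (g j)) \<in> snd (poset_tensor X Y)" by (simp only: eq)
      moreover have "g i < g j" using g(1) ij(1) by (simp add: strict_mono_def)
      ultimately show ?thesis by blast
    qed
    then show ?L using R unfolding snd_E_obj_iff[OF XY] by simp
  qed
  then show "snd (E_obj (poset_tensor X Y)) = snd (finiteness_tensor (E_obj X) (E_obj Y))"
    by (auto simp: finiteness_tensor_iff finiteness_space_E_obj X Y)
qed simp

section \<open>Strict monoidality of \<open>E\<close>\<close>

lemma E_obj_singleton: "E_obj ({x}, {(x, x)}) = ({x}, Pow {x})"
proof (rule prod_eqI)
  have "A \<in> snd (E_obj ({x}, {(x, x)})) \<longleftrightarrow> A \<subseteq> {x}" for A
  proof -
    have "(0::nat) < 1 \<and> (s 0, s 1) \<in> {(x, x)}" if "range s \<subseteq> A" "A \<subseteq> {x}" for s :: "nat \<Rightarrow> _"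
      using that by auto
    then have "\<exists>i j. i < j \<and> (s i, s j) \<in> {(x, x)}" if "range s \<subseteq> A" "A \<subseteq> {x}" for s :: "nat \<Rightarrow> _"
      using that by blast
    then show ?thesis
      using snd_E_obj_iff[of "({x}, {(x, x)})" A] partial_order_on_singleton[of x]
      unfolding fst_conv snd_conv by blast
  qed
  then show "snd (E_obj ({x}, {(x, x)})) = snd ({x}, Pow {x})" by auto
qed simp

text \<open>\<open>E\<close> keeps underlying functions, and both categories use the same formulas
  for composites, tensor products and structural maps. The equations between arrows thus reduce to
  equality of sources and targets, given for tensor products and unit by \<open>E_obj_tensor\<close>
  and \<open>E_obj_singleton\<close>.\<close>

lemma strict_monoidal_functor_E: "strict_monoidal_functor StrPos FinF E"
  unfolding StrPos_eq FinF_eq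
proof (intro strict_monoidal_functor.intro is_functor.intro StrPos.monoidal_category_S
    FinF.monoidal_category_S StrPos.category_S FinF.category_S
    is_functor_axioms.intro strict_monoidal_functor_axioms.intro, goal_cases)
  case (1 X)
  then show ?case by (auto simp: E_def intro!: finiteness_space_E_obj)
next
  case (2 f X Y)
  then show ?case
    by (auto simp: E_def StrPos.mem_Hom_S_iff FinF.mem_Hom_S_iff
        intro!: finiteness_space_E_obj finiteness_map_E_obj)
next
  case (3 X)
  then show ?case by (simp add: E_def)
next
  case (4 f X Y g Z)
  then show ?case by (auto simp: E_def StrPos.mem_Hom_S_iff)
next
  case (5 X Y)
  then show ?case by (simp add: E_def split_beta E_obj_tensor)
next
  case (6 f X X' g Y Y')
  then show ?case by (auto simp: E_def StrPos.mem_Hom_S_iff E_obj_tensor)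
next
  case 7
  show ?case by (simp add: E_def E_obj_singleton partial_order_on_singleton)
next
  case (8 X Y Z)
  then show ?case by (simp add: E_def split_beta E_obj_tensor partial_order_on_poset_tensor)
next
  case (9 X)
  then show ?case by (simp add: E_def split_beta E_obj_tensor E_obj_singleton partial_order_on_singleton)
next
  case (10 X)
  then show ?case by (simp add: E_def split_beta E_obj_tensor E_obj_singleton partial_order_on_singleton)
qed

theorem theorem4:
  shows "is_functor (monoidal_category.Mon StrPos) (monoidal_category.Mon FinF) (Mon_functor E)"
  by (rule strict_monoidal_functor.is_functor_Mon[OF strict_monoidal_functor_E])

end
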